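(* Let $R_1=\{(0,0),(0,1),(0,2),(0,3),(2,1),(2,2),(3,1),(3,2)\}$, $R_2=\{(0,0),(0,1),(0,2),(0,3),(1,2),(1,3),(2,2),(2,3)\}$, $R_3=\{(0,0),(1,0),(2,0),(3,0),(1,2),(1,3),(2,2),(2,3)\}$, $R_4=\{(0,0),(1,0),(2,0),(3,0),(2,1),(2,2),(3,1),(3,2)\}$. Then $(123,R_j)\sim_{jd}(132,R_j)$ for each $j\in\{1,2,3,4\}$. Moreover, the four pairs $\{(123,R_j),(132,R_j)\}$, $j=1,2,3,4$, have the same joint distribution.
   Context: $S_n$ is the set of permutations $\pi=\pi_1\cdots\pi_n$ of $\{1,\dots,n\}$. A mesh pattern of length $k$ is a pair $(\tau,R)$ with $\tau\in S_k$ and $R\subseteq\{0,\dots,k\}\times\{0,\dots,k\}$ (the set of shaded boxes; box $(a,b)$ is the unit square with lower-left corner $(a,b)$). An occurrence of $(\tau,R)$ in $\pi\in S_n$ is a subsequence $\pi_{i_1}\cdots\pi_{i_k}$, $i_1<\dots<i_k$, order-isomorphic to $\tau$, such that, with $i_0=0$, $i_{k+1}=n+1$, with $v_1<\dots<v_k$ the values $\pi_{i_1},\dots,\pi_{i_k}$ in increasing order, and $v_0=0$, $v_{k+1}=n+1$, for each $(a,b)\in R$ there is no index $m$ with $i_a<m<i_{a+1}$ and $v_b<\pi_m<v_{b+1}$. Two mesh patterns $q_1,q_2$ are jointly equidistributed, written $q_1\sim_{jd}q_2$, if for all nonnegative integers $n,k,\ell$ the number of $\pi\in S_n$ with exactly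 $k$ occurrences of $q_1$ and $\ell$ occurrences of $q_2$ equals the number of $\pi\in S_n$ with exactly $\ell$ occurrences of $q_1$ and $k$ occurrences of $q_2$. The joint distribution of a pair $\{q_1,q_2\}$ (with $q_1$ having underlying permutation $123$ and $q_2$ having underlying permutation $132$) is the family of numbers $T_{n,k,\ell}$ of $\pi\in S_n$ with exactly $k$ occurrences of $q_1$ and $\ell$ occurrences of $q_2$; two pairs have the same joint distribution if these numbers agree for all $n,k,\ell$. *)

theory Defs
  imports "HOL-Combinatorics.Combinatorics"
begin

definition S :: "nat \<Rightarrow> nat list set" where
  "S n = permutations_of_set {1..n}"

text \<open>Letters are numbered from 1, so that the sentinel positions \<open>0\<close> and \<open>n + 1\<close> below
  lie outside the word.\<close>

definition letter :: "nat list \<Rightarrow> nat \<Rightarrow> nat" where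
  "letter \<pi> i = \<pi> ! (i - 1)"

definition order_isomorphic :: "nat list \<Rightarrow> nat list \<Rightarrow> bool" where
  "order_isomorphic xs ys \<longleftrightarrow>
     length xs = length ys \<and>
     (\<forall>i<length xs. \<forall>j<length xs. xs ! i < xs ! j \<longleftrightarrow> ys ! i < ys ! j)"

type_synonym mesh_pattern = "nat list \<times> (nat \<times> nat) set"

definition is_mesh_pattern :: "nat \<Rightarrow> mesh_pattern \<Rightarrow> bool" where
  "is_mesh_pattern k q \<longleftrightarrow> fst q \<in> S k \<and> snd q \<subseteq> {0..k} \<times> {0..k}"

text \<open>A subsequence of \<open>\<pi>\<close> is represented by the increasing list \<open>is\<close> of its positions
  \<open>i\<^sub>1 < \<dots> < i\<^sub>k\<close>; adding the sentinels in front and at the end makes index \<open>a\<close> of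
  the list \<open>cols\<close> equal to \<open>i\<^sub>a\<close> and index \<open>b\<close> of the list \<open>rows\<close> equal to \<open>v\<^sub>b\<close>.\<close>

definition is_occurrence :: "mesh_pattern \<Rightarrow> nat list \<Rightarrow> nat list \<Rightarrow> bool" where
  "is_occurrence q \<pi> is \<longleftrightarrow>
     (let n = length \<pi>;
          vs = map (letter \<pi>) is;
          cols = 0 # is @ [n + 1];
          rows = 0 # sort vs @ [n + 1]
      in sorted_wrt (<) is \<and> set is \<subseteq> {1..n} \<and> order_isomorphic vs (fst q) \<and>
         (\<forall>(a, b) \<in> snd q.
            \<not> (\<exists>m\<in>{1..n}. cols ! a < m \<and> m < cols ! (a + 1) \<and>
                 rows ! b < letter \<pi> m \<and> letter \<pi> m < rows ! (b + 1))))"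

definition occurrences :: "mesh_pattern \<Rightarrow> nat list \<Rightarrow> nat" where
  "occurrences q \<pi> = card {is. is_occurrence q \<pi> is}"

definition joint_distribution ::
    "mesh_pattern \<Rightarrow> mesh_pattern \<Rightarrow> nat \<Rightarrow> nat \<Rightarrow> nat \<Rightarrow> nat" where
  "joint_distribution q1 q2 n k l =
     card {\<pi> \<in> S n. occurrences q1 \<pi> = k \<and> occurrences q2 \<pi> = l}"

definition jointly_equidistributed :: "mesh_pattern \<Rightarrow> mesh_pattern \<Rightarrow> bool"
    (infix \<open>\<sim>\<^sub>j\<^sub>d\<close> 50) where
  "q1 \<sim>\<^sub>j\<^sub>d q2 \<longleftrightarrow>
     (\<forall>n k l. joint_distribution q1 q2 n k l = joint_distribution q1 q2 n l k)"

definition R1 :: "(nat \<times> nat) set" where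
  "R1 = {(0,0),(0,1),(0,2),(0,3),(2,1),(2,2),(3,1),(3,2)}"

definition R2 :: "(nat \<times> nat) set" where
  "R2 = {(0,0),(0,1),(0,2),(0,3),(1,2),(1,3),(2,2),(2,3)}"

definition R3 :: "(nat \<times> nat) set" where
  "R3 = {(0,0),(1,0),(2,0),(3,0),(1,2),(1,3),(2,2),(2,3)}"

definition R4 :: "(nat \<times> nat) set" where
  "R4 = {(0,0),(1,0),(2,0),(3,0),(2,1),(2,2),(3,1),(3,2)}"

lemma is_mesh_pattern_R:
  assumes "R \<in> {R1, R2, R3, R4}"
  shows "is_mesh_pattern 3 ([1,2,3], R)" "is_mesh_pattern 3 ([1,3,2], R)"
proof -
  have "R \<subseteq> {0..3} \<times> {0..3}"
    using assms by (auto simp: R1_def R2_def R3_def R4_def)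
  moreover have "[1,2,3] \<in> S 3" "[1,3,2] \<in> S 3"
    by (auto simp: S_def permutations_of_set_def)
  ultimately show "is_mesh_pattern 3 ([1,2,3], R)" "is_mesh_pattern 3 ([1,3,2], R)"
    by (simp_all add: is_mesh_pattern_def)
qed

end

theory Submission
  imports Defs
begin

text \<open>In each of the four meshes the first letter of an occurrence is forced to be \<open>\<pi>\<^sub>1\<close> (if
  column 0 is shaded) or the value 1 (if row 0 is shaded). What remains is a pair of letters in the
  word \<open>\<sigma>\<close> formed by the letters that lie to the right of and above the forced one. For \<open>R1\<close> and
  \<open>R4\<close> the pairs from \<open>123\<close> are the letters of \<open>\<sigma>\<close>, except the last, with no smaller letter to
  their right, and the pairs from \<open>132\<close> are the letters with exactly one smaller letter to their
  right. In the Lehmer code of \<open>\<sigma>\<close> these are the entries 0 and 1 other than the final one, and the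
  code entries are independent, so the two counts are jointly symmetric. For \<open>R2\<close> and \<open>R3\<close> the
  same holds for the reverse complement of \<open>\<sigma>\<close>. Finally, the length of \<open>\<sigma>\<close> is \<open>n - \<pi>\<^sub>1\<close> or
  \<open>n\<close> minus the position of 1, and given its length all orders of \<open>\<sigma>\<close> are equally likely.\<close>

subsection \<open>Counting permutations by a subword\<close>

lemma card_permutations_of_set_rec:
  assumes "finite A" "A \<noteq> {}"
  shows "card {w \<in> permutations_of_set A. P w} =
         (\<Sum>x\<in>A. card {w \<in> permutations_of_set (A - {x}). P (x # w)})"
proof -
  have "{w \<in> permutations_of_set A. P w} =
        (\<Union>x\<in>A. (#) x ` {w \<in> permutations_of_set (A - {x}). P (x # w)})"
    by (subst permutations_of_set_nonempty[OF assms(2)]) auto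
  also have "card \<dots> = (\<Sum>x\<in>A. card ((#) x ` {w \<in> permutations_of_set (A - {x}). P (x # w)}))"
    by (rule card_UN_disjoint) (use assms in auto)
  finally show ?thesis
    by (simp add: card_image)
qed

text \<open>A word on \<open>A\<close> is a shuffle of its subword on the letters satisfying
  \<open>P\<close> with its subword on the others. The binomial coefficient counts the shuffles, the
  factorial the orders of the other letters, and only the first subword matters for
  \<open>Q\<close>.\<close>

lemma card_permutations_of_set_filter:
  assumes "finite A"
  shows "card {w \<in> permutations_of_set A. Q (filter P w)} =
         (card A choose card {x \<in> A. P x}) * fact (card A - card {x \<in> A. P x}) *
         card {w \<in> permutations_of_set {x \<in> A. P x}. Q w}"
proof -
  define B where "B = {x \<in> A. P x}"
  define C where "C = {x \<in> A. \<not> P x}"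
  define W where "W = {w \<in> permutations_of_set B. Q w}"
  have fin: "finite B" "finite C" "finite W"
    using assms by (auto simp: B_def C_def W_def)
  have "A = B \<union> C" "B \<inter> C = {}"
    by (auto simp: B_def C_def)
  then have cardA: "card A = card B + card C"
    using fin by (simp add: card_Un_disjoint)
  have split: "filter P w = u \<and> filter (\<lambda>x. \<not> P x) w = v \<and> w \<in> permutations_of_set A"
    if "w \<in> shuffles u v" "u \<in> W" "v \<in> permutations_of_set C" for u v w
  proof -
    have uv: "set u = B" "set v = C" "distinct u" "distinct v"
      using that by (auto simp: W_def permutations_of_set_def)
    have disj: "set u \<inter> set v = {}"
      using uv \<open>B \<inter> C = {}\<close> by simp
    have w: "set w = A" "distinct w"
      using set_shuffles[OF that(1)] distinct_disjoint_shuffles[OF uv(3,4) disj that(1)] uv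
        \<open>A = B \<union> C\<close> by auto
    have "filter P w = filter (\<lambda>x. x \<in> set u) w" "filter (\<lambda>x. \<not> P x) w = filter (\<lambda>x. x \<notin> set u) w"
      using w uv by (auto intro!: filter_cong simp: B_def)
    with filter_shuffles_disjoint1[OF disj that(1)] w show ?thesis
      by auto
  qed
  have "{w \<in> permutations_of_set A. Q (filter P w)} =
        (\<Union>(u, v)\<in>W \<times> permutations_of_set C. shuffles u v)" (is "?L = ?R")
  proof
    show "?L \<subseteq> ?R"
    proof
      fix w assume "w \<in> ?L"
      then have "filter P w \<in> W" "filter (\<lambda>x. \<not> P x) w \<in> permutations_of_set C"
        by (auto simp: W_def B_def C_def permutations_of_set_def)
      with partition_in_shuffles[of w P] show "w \<in> ?R"
        by blast
    qed
    show "?R \<subseteq> ?L"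
      using split by (fastforce simp: W_def)
  qed
  also have "card \<dots> = (\<Sum>(u, v)\<in>W \<times> permutations_of_set C. card (shuffles u v))"
  \<comment> \<open>By \<open>split\<close> a word recovers \<open>u\<close> and \<open>v\<close> as
    its two filters, so shuffles of different pairs are disjoint.\<close>
  proof (subst card_UN_disjoint)
    show "\<forall>p\<in>W \<times> permutations_of_set C. \<forall>q\<in>W \<times> permutations_of_set C. p \<noteq> q \<longrightarrow>
      (case p of (u, v) \<Rightarrow> shuffles u v) \<inter> (case q of (u, v) \<Rightarrow> shuffles u v) = {}"
      using split by (clarsimp simp: disjoint_iff) metis
  qed (use fin in \<open>auto intro!: sum.cong\<close>)
  also have "\<dots> = (\<Sum>(u, v)\<in>W \<times> permutations_of_set C. card A choose card B)"
  proof (rule sum.cong)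
    fix p assume p: "p \<in> W \<times> permutations_of_set C"
    obtain u v where "p = (u, v)" by fastforce
    with p have uv: "set u = B" "set v = C" "length u = card B" "length v = card C"
      by (auto simp: W_def permutations_of_set_def distinct_card)
    then have "set u \<inter> set v = {}"
      using \<open>B \<inter> C = {}\<close> by simp
    from card_disjoint_shuffles[OF this] uv cardA \<open>p = (u, v)\<close>
    show "(case p of (u, v) \<Rightarrow> card (shuffles u v)) = (case p of (u, v) \<Rightarrow> card A choose card B)"
      by simp
  qed simp
  also have "\<dots> = (card A choose card B) * fact (card C) * card W"
    using fin by (simp add: card_cartesian_product)
  finally show ?thesis
    using cardA by (simp add: W_def B_def)
qed

text \<open>If \<open>c m\<close> counts the good words on \<open>m\<close> letters, this is to
  count the permutations of \<open>n\<close> letters whose subword beyond a pinned letter is good.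
  The recursion looks at the first letter: it is the pinned one, or one of \<open>n\<close> others.
  The value at 0 reflects that the empty permutation has an empty subword.\<close>

fun pinned_count :: "(nat \<Rightarrow> nat) \<Rightarrow> nat \<Rightarrow> nat" where
  "pinned_count c 0 = c 0"
| "pinned_count c (Suc n) = c n + n * pinned_count c n"

text \<open>The bridge between pinning a value and pinning a position: the recursion arises when the
  letter 1 is pinned, the sum when the first letter is pinned and \<open>m\<close> letters exceed
  it.\<close>

lemma pinned_count_sum: "pinned_count c (Suc n) = (\<Sum>m\<le>n. (n choose m) * fact (n - m) * c m)"
proof (induction n)
  case 0
  then show ?case by simp
next
  case (Suc n)
  \<comment> \<open>The coefficient is \<open>fact n\<close> divided by \<open>fact m\<close>, so
    passing to \<open>Suc n\<close> multiplies it by \<open>Suc n\<close>. The new summand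
    \<open>m = Suc n\<close> has coefficient 1 and supplies the term \<open>c (Suc n)\<close> of the
    recursion.\<close>
  have "(Suc n choose m) * fact (Suc n - m) = Suc n * ((n choose m) * fact (n - m))"
    if "m \<le> n" for m
  proof -
    have "fact m * ((Suc n choose m) * fact (Suc n - m)) = (fact (Suc n) :: nat)"
      using binomial_fact_lemma[of m "Suc n"] that by (simp add: ac_simps)
    also have "\<dots> = Suc n * (fact m * ((n choose m) * fact (n - m)))"
      using binomial_fact_lemma[of m n] that by (simp add: ac_simps)
    finally have "fact m * ((Suc n choose m) * fact (Suc n - m)) =
      fact m * (Suc n * ((n choose m) * fact (n - m)))"
      by (simp only: ac_simps)
    then show ?thesis
      by (metis fact_nonzero mult_cancel1)
  qed
  then have "(\<Sum>m\<le>n. (Suc n choose m) * fact (Suc n - m) * c m) =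
    (\<Sum>m\<le>n. Suc n * ((n choose m) * fact (n - m) * c m))"
    by (intro sum.cong refl) (metis atMost_iff mult.assoc)
  also have "\<dots> = Suc n * pinned_count c (Suc n)"
    by (simp only: Suc.IH sum_distrib_left)
  finally show ?case
    by (simp add: pinned_count.simps(2)[of c "Suc n"] del: pinned_count.simps)
qed

text \<open>A first letter \<open>x\<close> leaves \<open>n - x\<close> greater letters, which form
  a subword of the remaining \<open>n - 1\<close> letters; summing over \<open>m = n - x\<close>
  gives the closed form of \<open>pinned_count\<close>.\<close>

lemma card_filter_greater_hd:
  assumes c: "\<And>B :: nat set. finite B \<Longrightarrow> card {w \<in> permutations_of_set B. Q w} = c (card B)"
  shows "card {\<pi> \<in> S n. Q (filter (\<lambda>u. hd \<pi> < u) (tl \<pi>))} = pinned_count c n"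
proof (cases n)
  case 0
  have "{\<pi> \<in> S 0. Q (filter (\<lambda>u. hd \<pi> < u) (tl \<pi>))} = {w \<in> permutations_of_set {}. Q w}"
    by (auto simp: S_def)
  with c[of "{}"] 0 show ?thesis
    by simp
next
  case (Suc n')
  have "card {w \<in> permutations_of_set ({1..n} - {x}). Q (filter (\<lambda>u. x < u) w)} =
      (n' choose (n - x)) * fact (n' - (n - x)) * c (n - x)"
    if "x \<in> {1..n}" for x
  proof -
    have "{u \<in> {1..n} - {x}. x < u} = {x<..n}"
      using that by auto
    then show ?thesis
      using that Suc by (simp add: card_permutations_of_set_filter c)
  qed
  then have "card {\<pi> \<in> S n. Q (filter (\<lambda>u. hd \<pi> < u) (tl \<pi>))} =
    (\<Sum>x\<in>{1..n}. (n' choose (n - x)) * fact (n' - (n - x)) * c (n - x))"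
    using Suc by (simp add: S_def card_permutations_of_set_rec)
  also have "\<dots> = (\<Sum>m\<le>n'. (n' choose m) * fact (n' - m) * c m)"
    by (rule sum.reindex_bij_witness[of _ "\<lambda>m. n - m" "\<lambda>x. n - x"]) (use Suc in auto)
  finally show ?thesis
    unfolding Suc by (simp only: pinned_count_sum)
qed

definition suffix_after :: "'a \<Rightarrow> 'a list \<Rightarrow> 'a list" where
  "suffix_after e w = tl (dropWhile (\<lambda>x. x \<noteq> e) w)"

lemma suffix_after_simps [simp]:
  "suffix_after e [] = []"
  "suffix_after e (x # w) = (if x = e then w else suffix_after e w)"
  by (auto simp: suffix_after_def)

lemma card_suffix_after:
  assumes "finite A" "e \<in> A"
    and c: "\<And>B. finite B \<Longrightarrow> card {w \<in> permutations_of_set B. Q w} = c (card B)"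
  shows "card {w \<in> permutations_of_set A. Q (suffix_after e w)} = pinned_count c (card A)"
  using assms(1,2)
proof (induction "card A" arbitrary: A)
  case 0
  then show ?case by auto
next
  case (Suc n)
  then have A: "card (A - {e}) = n" "A = insert e (A - {e})"
    by auto
  have "card {w \<in> permutations_of_set A. Q (suffix_after e w)} =
    (\<Sum>x\<in>A. card {w \<in> permutations_of_set (A - {x}). Q (suffix_after e (x # w))})"
    using Suc.prems by (intro card_permutations_of_set_rec) auto
  also have "\<dots> = (\<Sum>x\<in>A. if x = e then c n else pinned_count c n)"
  proof (rule sum.cong)
    fix x assume x: "x \<in> A"
    have "card (A - {x}) = n"
      using x Suc by simp
    then show "card {w \<in> permutations_of_set (A - {x}). Q (suffix_after e (x # w))} =
      (if x = e then c n else pinned_count c n)"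
      using c[of "A - {x}"] Suc.hyps(1)[of "A - {x}"] Suc.prems by auto
  qed simp
  also have "\<dots> = c n + n * pinned_count c n"
    by (subst A(2), subst sum.insert) (use Suc.prems A(1) in \<open>auto simp: sum.If_cases\<close>)
  finally show ?case
    by (simp flip: Suc.hyps(2))
qed

lemma card_suffix_after_S:
  assumes c: "\<And>B :: nat set. finite B \<Longrightarrow> card {w \<in> permutations_of_set B. Q w} = c (card B)"
  shows "card {\<pi> \<in> S n. Q (suffix_after 1 \<pi>)} = pinned_count c n"
proof (cases n)
  case 0
  have "{\<pi> \<in> S 0. Q (suffix_after 1 \<pi>)} = {w \<in> permutations_of_set {}. Q w}"
    by (auto simp: S_def)
  with c[of "{}"] 0 show ?thesis
    by simp
next
  case (Suc n')
  then show ?thesis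
    using card_suffix_after[of "{1..n}" 1 Q c] c by (simp add: S_def)
qed

subsection \<open>Pair statistics of a word\<close>

text \<open>On the letters of a distinct word this is a strict linear order. It allows positions to
  be replaced by letters throughout.\<close>

primrec precedes :: "'a list \<Rightarrow> 'a \<Rightarrow> 'a \<Rightarrow> bool" where
  "precedes [] x y \<longleftrightarrow> False"
| "precedes (a # w) x y \<longleftrightarrow> x = a \<and> y \<in> set w \<or> precedes w x y"

lemma precedes_set: "precedes w x y \<Longrightarrow> x \<in> set w \<and> y \<in> set w"
  by (induction w) auto

lemma precedes_append:
  "precedes (v @ w) x y \<longleftrightarrow> precedes v x y \<or> precedes w x y \<or> x \<in> set v \<and> y \<in> set w"
  by (induction v) auto

lemma precedes_rev: "precedes (rev w) x y \<longleftrightarrow> precedes w y x"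
  by (induction w) (auto simp: precedes_append)

lemma precedes_map: "inj f \<Longrightarrow> precedes (map f w) (f x) (f y) \<longleftrightarrow> precedes w x y"
  by (induction w) (auto simp: inj_eq)

lemma precedes_filter: "precedes (filter P w) x y \<longleftrightarrow> P x \<and> P y \<and> precedes w x y"
  by (induction w) auto

lemma precedes_suffix_after:
  "distinct w \<Longrightarrow> precedes (suffix_after e w) x y \<longleftrightarrow> precedes w e x \<and> precedes w x y"
  by (induction w) (auto dest: precedes_set)

lemma precedes_nth:
  "precedes w x y \<longleftrightarrow> (\<exists>j<length w. \<exists>i<j. w ! i = x \<and> w ! j = y)"
proof (induction w)
  case (Cons a w)
  have "precedes (a # w) x y \<longleftrightarrow>
    (\<exists>j<length w. a = x \<and> w ! j = y) \<or> (\<exists>j<length w. \<exists>i<j. w ! i = x \<and> w ! j = y)"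
    by (auto simp: Cons.IH in_set_conv_nth)
  then show ?case
    by (simp add: Ex_less_Suc2) blast
qed simp

lemma precedes_irrefl: "distinct w \<Longrightarrow> \<not> precedes w x x"
  by (induction w) (auto dest: precedes_set)

lemma precedes_trans: "distinct w \<Longrightarrow> precedes w x y \<Longrightarrow> precedes w y z \<Longrightarrow> precedes w x z"
  by (induction w) (auto dest: precedes_set)

lemma precedes_total:
  "x \<in> set w \<Longrightarrow> y \<in> set w \<Longrightarrow> x \<noteq> y \<Longrightarrow> precedes w x y \<or> precedes w y x"
  by (induction w) auto

lemma minimal_iff_hd:
  assumes "distinct w" "x \<in> set w"
  shows "(\<forall>u. \<not> precedes w u x) \<longleftrightarrow> x = hd w"
  using assms by (cases w) (auto dest: precedes_set)

section \<open>Pair statistics and the entries 0 and 1 of the Lehmer code\<close>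

text \<open>In a distinct word \<open>y\<close> determines \<open>z\<close> as the least letter to
  its right, so the pairs correspond to the letters other than the last that have no smaller letter
  to their right.\<close>

definition asc_pairs :: "'a::linorder list \<Rightarrow> ('a \<times> 'a) set" where
  "asc_pairs w = {(y, z). precedes w y z \<and> y < z \<and> (\<forall>u. precedes w y u \<longrightarrow> z \<le> u)}"

text \<open>Here \<open>z\<close> is the only smaller letter to the right of \<open>y\<close>, so
  the pairs correspond to the letters with Lehmer code entry 1.\<close>

definition desc_pairs :: "'a::linorder list \<Rightarrow> ('a \<times> 'a) set" where
  "desc_pairs w = {(y, z). precedes w y z \<and> z < y \<and> (\<forall>u. precedes w y u \<longrightarrow> u < y \<longrightarrow> u = z)}"

lemma asc_desc_pairs_simps:
  "asc_pairs [] = {}" "asc_pairs [x] = {}" "desc_pairs [] = {}" "desc_pairs [x] = {}"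
  by (auto simp: asc_pairs_def desc_pairs_def)

lemma finite_asc_desc_pairs: "finite (asc_pairs w)" "finite (desc_pairs w)"
  by (rule finite_subset[of _ "set w \<times> set w"];
      auto simp: asc_pairs_def desc_pairs_def dest: precedes_set)+

text \<open>The conditions on a pair concern only letters to the right of \<open>y\<close>, so the
  pairs of \<open>w\<close> survive. The only possible new pair joins \<open>x\<close> to the
  minimum of \<open>w\<close>, which exists because \<open>w\<close> is nonempty.\<close>

lemma card_asc_pairs_Cons:
  assumes "x \<notin> set w" "w \<noteq> []"
  shows "card (asc_pairs (x # w)) = card (asc_pairs w) + (if \<forall>u\<in>set w. x < u then 1 else 0)"
proof -
  have "asc_pairs (x # w) =
    asc_pairs w \<union> (if \<forall>u\<in>set w. x < u then {(x, Min (set w))} else {})"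
    using assms by (auto simp: asc_pairs_def Min_le_iff Min_gr_iff dest: precedes_set
        intro!: Min_eqI[symmetric] intro: less_le_trans)
  moreover have "(x, z) \<notin> asc_pairs w" for z
    using assms by (auto simp: asc_pairs_def dest: precedes_set)
  ultimately show ?thesis
    by (simp add: finite_asc_desc_pairs)
qed

lemma card_desc_pairs_Cons:
  assumes "x \<notin> set w"
  shows "card (desc_pairs (x # w)) = card (desc_pairs w) + (if \<exists>!u\<in>set w. u < x then 1 else 0)"
proof -
  have "desc_pairs (x # w) =
    desc_pairs w \<union> (if \<exists>!u\<in>set w. u < x then {(x, THE u. u \<in> set w \<and> u < x)} else {})"
  proof (cases "\<exists>!u\<in>set w. u < x")
    case True
    then have "(THE u. u \<in> set w \<and> u < x) \<in> set w \<and> (THE u. u \<in> set w \<and> u < x) < x"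
      by (rule theI')
    with True show ?thesis
      using assms by (auto simp: desc_pairs_def dest: precedes_set)
  next
    case False
    then show ?thesis
      using assms by (auto simp: desc_pairs_def dest: precedes_set)
  qed
  moreover have "(x, z) \<notin> desc_pairs w" for z
    using assms by (auto simp: desc_pairs_def dest: precedes_set)
  ultimately show ?thesis
    by (simp add: finite_asc_desc_pairs)
qed

text \<open>The recursion prepends a letter \<open>x\<close> to a nonempty word: a new \<open>asc\<close> pair arises exactly when \<open>x\<close>
  is the least letter, a new \<open>desc\<close> pair exactly when \<open>x\<close> is the second least one.\<close>

fun pair_count :: "nat \<Rightarrow> nat \<Rightarrow> nat \<Rightarrow> nat" where
  "pair_count 0 k l = (if k = 0 \<and> l = 0 then 1 else 0)"
| "pair_count (Suc 0) k l = (if k = 0 \<and> l = 0 then 1 else 0)"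
| "pair_count (Suc (Suc m)) k l =
     (case k of 0 \<Rightarrow> 0 | Suc k' \<Rightarrow> pair_count (Suc m) k' l) +
     (case l of 0 \<Rightarrow> 0 | Suc l' \<Rightarrow> pair_count (Suc m) k l') +
     m * pair_count (Suc m) k l"

text \<open>Exchanging \<open>k\<close> and \<open>l\<close> exchanges the first two summands of the
  recursion. The joint equidistribution rests on this symmetry.\<close>

lemma pair_count_commute: "pair_count m k l = pair_count m l k"
  by (induction m k l rule: pair_count.induct) (auto split: nat.splits)

text \<open>Words are split by their first letter. Only the least letter \<open>p\<close> adds an
  ascending pair and only the second least letter \<open>q\<close> a descending one; the other
  \<open>m\<close> letters add nothing.\<close>

lemma card_permutations_asc_desc:
  fixes A :: "'a::linorder set"
  assumes "finite A"
  shows "card {w \<in> permutations_of_set A. card (asc_pairs w) = k \<and> card (desc_pairs w) = l} =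
    pair_count (card A) k l"
  using assms
proof (induction "card A" k l arbitrary: A rule: pair_count.induct)
  case (1 k l)
  then have "A = {}" by simp
  then show ?case
    by (simp add: asc_desc_pairs_simps cong: conj_cong)
next
  case (2 k l)
  then obtain x where "A = {x}"
    by (metis card_1_singletonE One_nat_def)
  then show ?case
    by (simp add: asc_desc_pairs_simps cong: conj_cong)
next
  case (3 m k l)
  let ?N = "\<lambda>B k l. card {w \<in> permutations_of_set B. card (asc_pairs w) = k \<and> card (desc_pairs w) = l}"
  define p where "p = Min A"
  define q where "q = Min (A - {p})"
  have A: "A \<noteq> {}" "A - {p} \<noteq> {}"
    using 3(4) card_mono[of "{p}" A] by auto
  have p: "p \<in> A" "\<And>u. u \<in> A \<Longrightarrow> p \<le> u"
    using A \<open>finite A\<close> by (auto simp: p_def)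
  have q: "q \<in> A - {p}" "\<And>u. u \<in> A - {p} \<Longrightarrow> q \<le> u"
    using A(2) \<open>finite A\<close> unfolding q_def by (auto simp del: Diff_iff)
  have min: "(\<forall>u\<in>A - {x}. x < u) \<longleftrightarrow> x = p" if "x \<in> A" for x
    using that p by (metis Diff_iff insertCI insertE leD order.not_eq_order_implies_strict singletonD)
  \<comment> \<open>Below \<open>p\<close> there is no letter, and below any letter other than
    \<open>p\<close> and \<open>q\<close> there are at least these two.\<close>
  have second: "(\<exists>!u\<in>A - {x}. u < x) \<longleftrightarrow> x = q" if "x \<in> A" for x
  proof
    assume ex1: "\<exists>!u\<in>A - {x}. u < x"
    show "x = q"
    proof (rule ccontr)
      assume "x \<noteq> q"
      have "x \<noteq> p"
        using ex1 p(2) by (metis Diff_iff leD)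
      then have "p < x" "q < x"
        using that p(2)[of x] q(2)[of x] \<open>x \<noteq> q\<close> by auto
      then show False
        using ex1 p(1) q(1) by blast
    qed
  next
    assume "x = q"
    have "p < q"
      using p(2)[of q] q(1) by auto
    moreover have "u = p" if "u \<in> A" "u < q" for u
      using q(2)[of u] that by (meson Diff_iff leD singletonD)
    ultimately show "\<exists>!u\<in>A - {x}. u < x"
      using p(1) \<open>x = q\<close> by blast
  qed
  have "?N A k l = (\<Sum>x\<in>A. card {w \<in> permutations_of_set (A - {x}).
    card (asc_pairs (x # w)) = k \<and> card (desc_pairs (x # w)) = l})"
    using A \<open>finite A\<close> by (intro card_permutations_of_set_rec)
  also have "\<dots> = (\<Sum>x\<in>A. if x = p then (case k of 0 \<Rightarrow> 0 | Suc k' \<Rightarrow> pair_count (Suc m) k' l)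
    else if x = q then (case l of 0 \<Rightarrow> 0 | Suc l' \<Rightarrow> pair_count (Suc m) k l')
    else pair_count (Suc m) k l)" (is "_ = sum ?f A")
  proof (rule sum.cong)
    fix x assume x: "x \<in> A"
    define B where "B = A - {x}"
    have B: "card B = Suc m" "finite B"
      using x 3(5) by (simp_all add: B_def card_Diff_singleton flip: 3(4))
    have stats: "card (asc_pairs (x # w)) = card (asc_pairs w) + (if x = p then 1 else 0)"
      "card (desc_pairs (x # w)) = card (desc_pairs w) + (if x = q then 1 else 0)"
      if "w \<in> permutations_of_set B" for w
    proof -
      have w: "set w = A - {x}"
        using that by (simp add: permutations_of_set_def B_def)
      have "x \<notin> set w"
        by (simp add: w)
      moreover have "w \<noteq> []"
        using w B(1) by (force simp flip: B_def)
      ultimately show "card (asc_pairs (x # w)) = card (asc_pairs w) + (if x = p then 1 else 0)"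
        "card (desc_pairs (x # w)) = card (desc_pairs w) + (if x = q then 1 else 0)"
        using card_asc_pairs_Cons[of x w] card_desc_pairs_Cons[of x w]
        unfolding w min[OF x] second[OF x] by blast+
    qed
    have eq: "{w \<in> permutations_of_set B. card (asc_pairs (x # w)) = k \<and> card (desc_pairs (x # w)) = l}
      = {w \<in> permutations_of_set B. card (asc_pairs w) + (if x = p then 1 else 0) = k \<and>
          card (desc_pairs w) + (if x = q then 1 else 0) = l}"
      using stats by auto
    have "?N B k l = pair_count (Suc m) k l"
      "\<And>k'. k = Suc k' \<Longrightarrow> ?N B k' l = pair_count (Suc m) k' l"
      "\<And>l'. l = Suc l' \<Longrightarrow> ?N B k l' = pair_count (Suc m) k l'"
      using 3(1)[of _ B] 3(2)[of _ B] 3(3)[of B] B by auto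
    with q(1) show "card {w \<in> permutations_of_set (A - {x}).
      card (asc_pairs (x # w)) = k \<and> card (desc_pairs (x # w)) = l} = ?f x"
      unfolding B_def[symmetric] eq by (auto split: nat.splits)
  qed simp
  also have "\<dots> = ?f p + (?f q + sum ?f (A - {p} - {q}))"
    using p q \<open>finite A\<close> by (simp add: sum.remove[of A p] sum.remove[of "A - {p}" q])
  also have "sum ?f (A - {p} - {q}) = (\<Sum>x\<in>A - {p} - {q}. pair_count (Suc m) k l)"
    by (rule sum.cong) auto
  also have "\<dots> = m * pair_count (Suc m) k l"
    using p(1) q(1) 3(5) by (simp flip: 3(4))
  finally show ?case
    using q(1) by (simp flip: 3(4))
qed

section \<open>The mirrored statistics and the reverse complement\<close>

definition coasc_pairs :: "'a::linorder list \<Rightarrow> ('a \<times> 'a) set" where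
  "coasc_pairs w = {(y, z). precedes w y z \<and> y < z \<and> (\<forall>u. precedes w u z \<longrightarrow> u \<le> y)}"

definition codesc_pairs :: "'a::linorder list \<Rightarrow> ('a \<times> 'a) set" where
  "codesc_pairs w = {(y, z). precedes w y z \<and> z < y \<and> (\<forall>u. precedes w u z \<longrightarrow> z < u \<longrightarrow> u = y)}"

text \<open>A reverse complement whose complement is negation into the integers, so that it does not
  depend on the alphabet of the word.\<close>

definition rev_uminus :: "nat list \<Rightarrow> int list" where
  "rev_uminus w = rev (map (\<lambda>v. - int v) w)"

lemma precedes_rev_uminus:
  "precedes (rev_uminus w) s t \<longleftrightarrow> (\<exists>x y. s = - int x \<and> t = - int y \<and> precedes w y x)"
proof -
  have inj: "inj (\<lambda>v. - int v)"
    by (auto simp: inj_def)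
  have "precedes (rev_uminus w) s t \<Longrightarrow> s \<in> range (\<lambda>v. - int v) \<and> t \<in> range (\<lambda>v. - int v)"
    by (drule precedes_set) (auto simp: rev_uminus_def)
  then show ?thesis
    using precedes_map[OF inj] by (fastforce simp: rev_uminus_def precedes_rev)
qed

text \<open>Reversal swaps the two positions and negation swaps the order of values, so the pair
  \<open>(y, z)\<close> corresponds to the pair of \<open>- z\<close> and \<open>- y\<close>, and
  conditions to the left of \<open>z\<close> become conditions to the right of its image.\<close>

lemma card_coasc_codesc_pairs:
  "card (coasc_pairs w) = card (asc_pairs (rev_uminus w))"
  "card (codesc_pairs w) = card (desc_pairs (rev_uminus w))"
proof -
  let ?f = "\<lambda>(y, z). (- int z, - int y)"
  have inj: "inj_on ?f X" for X
    by (auto simp: inj_on_def)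
  have image: "X = ?f ` Y"
    if "\<And>y z. (- int z, - int y) \<in> X \<longleftrightarrow> (y, z) \<in> Y"
      and "\<And>p. p \<in> X \<Longrightarrow> \<exists>y z. p = (- int z, - int y)" for X Y
  proof
    show "X \<subseteq> ?f ` Y"
    proof
      fix p assume "p \<in> X"
      with that obtain y z where "p = ?f (y, z)" "(y, z) \<in> Y"
        by fastforce
      then show "p \<in> ?f ` Y"
        by (rule image_eqI)
    qed
  qed (use that(1) in auto)
  have "asc_pairs (rev_uminus w) = ?f ` coasc_pairs w"
    by (rule image) (auto simp: asc_pairs_def coasc_pairs_def precedes_rev_uminus)
  moreover have "desc_pairs (rev_uminus w) = ?f ` codesc_pairs w"
    by (rule image) (auto simp: desc_pairs_def codesc_pairs_def precedes_rev_uminus)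
  ultimately show "card (coasc_pairs w) = card (asc_pairs (rev_uminus w))"
    "card (codesc_pairs w) = card (desc_pairs (rev_uminus w))"
    by (simp_all only: card_image[OF inj])
qed

lemma card_permutations_coasc_codesc:
  fixes A :: "nat set"
  assumes "finite A"
  shows "card {w \<in> permutations_of_set A. card (coasc_pairs w) = k \<and> card (codesc_pairs w) = l} =
    pair_count (card A) k l"
proof -
  let ?g = "\<lambda>v. - int v"
  have inj: "inj_on ?g A" "inj rev_uminus"
    by (auto simp: inj_on_def rev_uminus_def inj_map_eq_map)
  have "permutations_of_set (?g ` A) = rev_uminus ` permutations_of_set A"
    by (subst rev_permutations_of_set[symmetric], subst permutations_of_set_image_inj[OF inj(1)])
       (auto simp: rev_uminus_def image_image)
  then have "{w \<in> permutations_of_set (?g ` A). card (asc_pairs w) = k \<and> card (desc_pairs w) = l} =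
    rev_uminus ` {w \<in> permutations_of_set A. card (coasc_pairs w) = k \<and> card (codesc_pairs w) = l}"
    by (auto simp: card_coasc_codesc_pairs)
  with card_permutations_asc_desc[of "?g ` A" k l] assms show ?thesis
    by (simp only: card_image[OF inj_on_subset[OF inj(2) subset_UNIV]] card_image[OF inj(1)] finite_imageI)
qed

subsection \<open>Occurrences in terms of values\<close>

definition in_column :: "'a list \<Rightarrow> 'a \<Rightarrow> 'a \<Rightarrow> 'a \<Rightarrow> nat \<Rightarrow> 'a \<Rightarrow> bool" where
  "in_column w x y z a u \<longleftrightarrow>
    (if a = 0 then precedes w u x
     else if a = 1 then precedes w x u \<and> precedes w u y
     else if a = 2 then precedes w y u \<and> precedes w u z
     else precedes w z u)"

text \<open>The mesh condition with points indexed by letters instead of positions;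
  \<open>vs\<close> stands for the increasing rearrangement of \<open>x\<close>, \<open>y\<close>,
  \<open>z\<close>.\<close>

definition avoids :: "(nat \<times> nat) set \<Rightarrow> nat list \<Rightarrow> nat \<Rightarrow> nat \<Rightarrow> nat \<Rightarrow> nat list \<Rightarrow> bool" where
  "avoids R w x y z vs \<longleftrightarrow>
    (\<forall>(a, b)\<in>R. \<forall>u\<in>set w. in_column w x y z a u \<longrightarrow>
       \<not> ((0 # vs @ [length w + 1]) ! b < u \<and> u < (0 # vs @ [length w + 1]) ! (b + 1)))"

text \<open>Allows the four boxes that pin the first letter and the other four boxes to be treated
  separately.\<close>

lemma avoids_Un: "avoids (R \<union> R') w x y z vs \<longleftrightarrow> avoids R w x y z vs \<and> avoids R' w x y z vs"
  by (auto simp: avoids_def)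

lemma letter_bij:
  assumes "distinct w"
  shows "inj_on (letter w) {1..length w}" "letter w ` {1..length w} = set w"
proof -
  have "i - 1 < length w" if "i \<in> {1..length w}" for i
    using that by auto
  then show "inj_on (letter w) {1..length w}"
    using assms by (auto simp: inj_on_def letter_def nth_eq_iff_index_eq)
  have "letter w ` Suc ` {..<length w} = (!) w ` {0..<length w}"
    unfolding image_image letter_def by (simp add: lessThan_atLeast0)
  then show "letter w ` {1..length w} = set w"
    by (simp only: image_Suc_lessThan nth_image order_refl take_all)
qed

lemma precedes_letter:
  assumes "distinct w" "i \<in> {1..length w}" "j \<in> {1..length w}"
  shows "precedes w (letter w i) (letter w j) \<longleftrightarrow> i < j"
proof -
  have "i - 1 < length w" "j - 1 < length w"
    using assms by auto
  then have "precedes w (letter w i) (letter w j) \<longleftrightarrow> i - 1 < j - 1"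
    using assms(1) by (fastforce simp: precedes_nth letter_def nth_eq_iff_index_eq)
  with assms show ?thesis by auto
qed

text \<open>In a distinct word \<open>letter w\<close> is a bijection from positions to letters that
  turns \<open><\<close> into \<open>precedes w\<close>, so the mesh condition translates box by
  box. The parameters \<open>P\<close> and \<open>vs\<close> abstract the pattern, to serve both
  \<open>123\<close> and \<open>132\<close>.\<close>

lemma is_occurrence_letters:
  assumes w: "distinct w" and R: "R \<subseteq> {0..3} \<times> {0..3}"
    and \<tau>: "length \<tau> = 3" "\<And>x y z. order_isomorphic [x, y, z] \<tau> \<longleftrightarrow> P x y z"
    and vs: "\<And>x y z. P x y z \<Longrightarrow> sort [x, y, z] = vs x y z"
  shows "is_occurrence (\<tau>, R) w is \<longleftrightarrow>
    (\<exists>i j k. is = [i, j, k] \<and> {i, j, k} \<subseteq> {1..length w} \<and>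
      (let x = letter w i; y = letter w j; z = letter w k
       in precedes w x y \<and> precedes w y z \<and> P x y z \<and> avoids R w x y z (vs x y z)))"
proof (cases "\<exists>i j k. is = [i, j, k] \<and> {i, j, k} \<subseteq> {1..length w} \<and> i < j \<and> j < k \<and>
    P (letter w i) (letter w j) (letter w k)")
  case True
  then obtain i j k where ijk: "is = [i, j, k]" "{i, j, k} \<subseteq> {1..length w}" "i < j" "j < k"
    and P: "P (letter w i) (letter w j) (letter w k)"
    by blast
  let ?x = "letter w i" and ?y = "letter w j" and ?z = "letter w k"
  let ?cols = "0 # is @ [length w + 1]" and ?rows = "0 # vs ?x ?y ?z @ [length w + 1]"
  have col: "in_column w ?x ?y ?z a (letter w m) \<longleftrightarrow> ?cols ! a < m \<and> m < ?cols ! (a + 1)"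
    if "a \<le> 3" "m \<in> {1..length w}" for a m
  proof -
    have "a = 0 \<or> a = 1 \<or> a = 2 \<or> a = 3"
      using that by linarith
    then show ?thesis
      using ijk that(2) precedes_letter[OF w] by (auto simp: in_column_def numeral_eq_Suc)
  qed
  have "(\<forall>u\<in>set w. in_column w ?x ?y ?z a u \<longrightarrow> \<not> (?rows ! b < u \<and> u < ?rows ! (b + 1))) \<longleftrightarrow>
    \<not> (\<exists>m\<in>{1..length w}. ?cols ! a < m \<and> m < ?cols ! (a + 1) \<and>
      ?rows ! b < letter w m \<and> letter w m < ?rows ! (b + 1))" if "(a, b) \<in> R" for a b
  proof -
    have "a \<le> 3"
      using that R by auto
    then show ?thesis
      unfolding letter_bij(2)[OF w, symmetric] using col by blast
  qed
  then have "avoids R w ?x ?y ?z (vs ?x ?y ?z) \<longleftrightarrow>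
    (\<forall>(a, b)\<in>R. \<not> (\<exists>m\<in>{1..length w}. ?cols ! a < m \<and> m < ?cols ! (a + 1) \<and>
      ?rows ! b < letter w m \<and> letter w m < ?rows ! (b + 1)))"
    unfolding avoids_def by blast
  also have "\<dots> \<longleftrightarrow> is_occurrence (\<tau>, R) w is"
  proof -
    have map: "map (letter w) is = [?x, ?y, ?z]"
      using ijk(1) by simp
    have "sorted_wrt (<) is" "set is \<subseteq> {1..length w}" "order_isomorphic [?x, ?y, ?z] \<tau>"
      using ijk P \<tau>(2) by auto
    then show ?thesis
      unfolding is_occurrence_def Let_def map vs[OF P] fst_conv snd_conv by blast
  qed
  finally show ?thesis
    using ijk P precedes_letter[OF w] by (simp add: Let_def)
next
  \<comment> \<open>Here both sides fail: an occurrence has length 3 because \<open>\<tau>\<close>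
    has, and either side would then yield an increasing triple of positions satisfying
    \<open>P\<close>.\<close>
  case False
  have "\<not> is_occurrence (\<tau>, R) w is"
  proof
    assume occ: "is_occurrence (\<tau>, R) w is"
    then have "length is = 3"
      using \<tau> by (auto simp: is_occurrence_def order_isomorphic_def Let_def)
    then obtain i j k where "is = [i, j, k]"
      by (auto simp: numeral_eq_Suc length_Suc_conv)
    with occ \<tau>(2) False show False
      by (auto simp: is_occurrence_def Let_def)
  qed
  moreover have False if "is = [i, j, k]" and ijk: "{i, j, k} \<subseteq> {1..length w}"
    and prec: "precedes w (letter w i) (letter w j)" "precedes w (letter w j) (letter w k)"
    and "P (letter w i) (letter w j) (letter w k)" for i j k
  proof -
    have "i < j" "j < k"
      using ijk prec by (simp_all add: precedes_letter[OF w])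
    with False that show False
      by blast
  qed
  ultimately show ?thesis
    unfolding Let_def by blast
qed

lemma occurrences_eq_card_values:
  assumes w: "distinct w" and R: "R \<subseteq> {0..3} \<times> {0..3}"
    and \<tau>: "length \<tau> = 3" "\<And>x y z. order_isomorphic [x, y, z] \<tau> \<longleftrightarrow> P x y z"
    and vs: "\<And>x y z. P x y z \<Longrightarrow> sort [x, y, z] = vs x y z"
  shows "occurrences (\<tau>, R) w =
    card {(x, y, z). precedes w x y \<and> precedes w y z \<and> P x y z \<and> avoids R w x y z (vs x y z)}"
proof -
  let ?T = "{(x, y, z). precedes w x y \<and> precedes w y z \<and> P x y z \<and> avoids R w x y z (vs x y z)}"
  let ?f = "\<lambda>(i, j, k). (letter w i, letter w j, letter w k)"
  let ?I = "{1..length w} \<times> {1..length w} \<times> {1..length w}"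
  define D where "D = {p \<in> ?I. ?f p \<in> ?T}"
  note occ = is_occurrence_letters[of w R \<tau> P vs, OF w R \<tau> vs, unfolded Let_def]
  have "{is. is_occurrence (\<tau>, R) w is} = (\<lambda>(i, j, k). [i, j, k]) ` D"
    by (auto simp: occ D_def image_iff)
  then have "occurrences (\<tau>, R) w = card D"
    by (auto simp: occurrences_def intro!: card_image inj_onI)
  moreover have "inj_on ?f D"
    using letter_bij(1)[OF w] by (auto simp: D_def inj_on_def)
  moreover have "?f ` D = ?T"
  proof
    show "?T \<subseteq> ?f ` D"
    proof clarify
      fix x y z assume t: "precedes w x y" "precedes w y z" "P x y z" "avoids R w x y z (vs x y z)"
      then have "{x, y, z} \<subseteq> letter w ` {1..length w}"
        unfolding letter_bij(2)[OF w] by (auto dest: precedes_set)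
      then obtain i j k where "{i, j, k} \<subseteq> {1..length w}" "x = letter w i" "y = letter w j" "z = letter w k"
        by (auto simp: image_iff)
      with t show "(x, y, z) \<in> ?f ` D"
        unfolding D_def by (intro image_eqI[of _ _ "(i, j, k)"]) auto
    qed
  qed (auto simp: D_def)
  ultimately show ?thesis
    using card_image by fastforce
qed

section \<open>The shaded regions of the four meshes\<close>

text \<open>The values \<open>x, y, z\<close> of a candidate occurrence are listed in the order of their positions, and
  \<open>x < v2 < v3\<close> is their increasing rearrangement, so that the two patterns \<open>123\<close> and \<open>132\<close>
  are treated together.\<close>

locale occurrence_values =
  fixes w :: "nat list" and n x y z v2 v3 :: nat
  assumes w: "w \<in> S n"
    and prec: "precedes w x y" "precedes w y z"
    and vals: "v2 = y \<and> v3 = z \<or> v2 = z \<and> v3 = y"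
    and less: "x < v2" "v2 < v3"
begin

lemma distinct: "distinct w" and set_w: "set w = {1..n}" and length: "length w = n"
  using w distinct_card[of w] by (auto simp: S_def permutations_of_set_def)

lemma in_range: "u \<in> set w \<longleftrightarrow> 0 < u \<and> u < n + 1"
  by (auto simp: set_w)

lemmas order = precedes_irrefl[OF distinct] precedes_trans[OF distinct] precedes_set[of w]

lemma avoids_iff:
  assumes "\<And>u. u \<in> set w \<Longrightarrow>
    (\<forall>(a, b)\<in>R. in_column w x y z a u \<longrightarrow>
      \<not> ([0, x, v2, v3, n + 1] ! b < u \<and> u < [0, x, v2, v3, n + 1] ! (b + 1))) \<longleftrightarrow> Q u"
  shows "avoids R w x y z [x, v2, v3] \<longleftrightarrow> (\<forall>u\<in>set w. Q u)"
proof -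
  have "avoids R w x y z [x, v2, v3] \<longleftrightarrow>
    (\<forall>u\<in>set w. \<forall>(a, b)\<in>R. in_column w x y z a u \<longrightarrow>
      \<not> ([0, x, v2, v3, n + 1] ! b < u \<and> u < [0, x, v2, v3, n + 1] ! (b + 1)))"
    unfolding avoids_def length append.simps by blast
  then show ?thesis
    using assms by simp
qed

text \<open>A letter before \<open>x\<close> differs from all row boundaries, hence lies inside some
  box of the shaded column. So the column is empty exactly when nothing precedes
  \<open>x\<close>.\<close>

lemma avoids_column0:
  "avoids {(0,0),(0,1),(0,2),(0,3)} w x y z [x, v2, v3] \<longleftrightarrow> x = hd w"
proof -
  have "avoids {(0,0),(0,1),(0,2),(0,3)} w x y z [x, v2, v3] \<longleftrightarrow> (\<forall>u\<in>set w. \<not> precedes w u x)"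
  proof (rule avoids_iff)
    fix u assume u: "u \<in> set w"
    have "u \<noteq> x" "u \<noteq> v2" "u \<noteq> v3" if "precedes w u x"
      using that vals prec order(1,2) by blast+
    with u show "(\<forall>(a, b)\<in>{(0,0),(0,1),(0,2),(0,3)}. in_column w x y z a u \<longrightarrow>
      \<not> ([0, x, v2, v3, n + 1] ! b < u \<and> u < [0, x, v2, v3, n + 1] ! (b + 1))) \<longleftrightarrow>
      \<not> precedes w u x"
      by (auto simp: in_column_def in_range numeral_eq_Suc)
  qed
  also have "\<dots> \<longleftrightarrow> (\<forall>u. \<not> precedes w u x)"
    using order(3) by blast
  finally show ?thesis
    using minimal_iff_hd[OF distinct] prec order(3) by blast
qed

text \<open>A letter below \<open>x\<close> differs from \<open>x\<close>, \<open>y\<close> and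
  \<open>z\<close>, hence lies strictly inside some column. So the row is empty exactly when
  \<open>x\<close> is the least letter.\<close>

lemma avoids_row0:
  "avoids {(0,0),(1,0),(2,0),(3,0)} w x y z [x, v2, v3] \<longleftrightarrow> x = 1"
proof -
  have "avoids {(0,0),(1,0),(2,0),(3,0)} w x y z [x, v2, v3] \<longleftrightarrow> (\<forall>u\<in>set w. \<not> u < x)"
  proof (rule avoids_iff)
    fix u assume u: "u \<in> set w"
    have "precedes w u x \<or> precedes w x u \<and> precedes w u y \<or> precedes w y u \<and> precedes w u z \<or>
      precedes w z u" if "u < x"
    proof -
      have "u \<noteq> x" "u \<noteq> y" "u \<noteq> z"
        using that vals less by auto
      moreover have "x \<in> set w" "y \<in> set w" "z \<in> set w"
        using prec order(3) by blast+
      ultimately show ?thesis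
        using u precedes_total[of u w] by blast
    qed
    with u show "(\<forall>(a, b)\<in>{(0,0),(1,0),(2,0),(3,0)}. in_column w x y z a u \<longrightarrow>
      \<not> ([0, x, v2, v3, n + 1] ! b < u \<and> u < [0, x, v2, v3, n + 1] ! (b + 1))) \<longleftrightarrow> \<not> u < x"
      by (auto simp: in_column_def in_range)
  qed
  also have "\<dots> \<longleftrightarrow> x = 1"
  proof -
    have "x \<in> set w"
      using prec order(3) by blast
    then have "1 \<in> set w" "1 \<le> x"
      by (auto simp: set_w)
    then show ?thesis
      by (metis in_range le_antisym less_irrefl less_one not_less)
  qed
  finally show ?thesis .
qed

text \<open>The four boxes merge into the region to the right of \<open>y\<close> with values
  strictly between \<open>x\<close> and \<open>v3\<close>. On the lines separating them, this region
  contains no letter but possibly \<open>z\<close>, whence the exception.\<close>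

lemma avoids_lower_right:
  "avoids {(2,1),(2,2),(3,1),(3,2)} w x y z [x, v2, v3] \<longleftrightarrow>
   (\<forall>u. precedes w y u \<longrightarrow> x < u \<longrightarrow> u < v3 \<longrightarrow> u = z)"
proof -
  have "avoids {(2,1),(2,2),(3,1),(3,2)} w x y z [x, v2, v3] \<longleftrightarrow>
    (\<forall>u\<in>set w. precedes w y u \<longrightarrow> x < u \<longrightarrow> u < v3 \<longrightarrow> u = z)"
  proof (rule avoids_iff)
    fix u assume u: "u \<in> set w"
    have "z \<in> set w"
      using prec order(3) by blast
    then have "precedes w y u \<and> precedes w u z \<or> precedes w z u \<longleftrightarrow> precedes w y u \<and> u \<noteq> z"
      using u prec order(1,2) precedes_total[of u w z] by blast
    \<comment> \<open>The row boundary \<open>v2\<close> is the letter \<open>y\<close> or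
      \<open>z\<close>, and \<open>y\<close> does not follow itself.\<close>
    moreover have "u \<noteq> v2" if "precedes w y u" "u \<noteq> z"
      using that vals order(1) by blast
    ultimately show "(\<forall>(a, b)\<in>{(2,1),(2,2),(3,1),(3,2)}. in_column w x y z a u \<longrightarrow>
      \<not> ([0, x, v2, v3, n + 1] ! b < u \<and> u < [0, x, v2, v3, n + 1] ! (b + 1))) \<longleftrightarrow>
      (precedes w y u \<longrightarrow> x < u \<longrightarrow> u < v3 \<longrightarrow> u = z)"
      using less by (cases u v2 rule: linorder_cases) (auto simp: in_column_def numeral_eq_Suc)
  qed
  then show ?thesis
    using order(3) by blast
qed

text \<open>The four boxes merge into the region between the positions of \<open>x\<close> and
  \<open>z\<close> with values above \<open>v2\<close>; the only letter it may contain on the inner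
  lines is \<open>y\<close>.\<close>

lemma avoids_upper_left:
  "avoids {(1,2),(1,3),(2,2),(2,3)} w x y z [x, v2, v3] \<longleftrightarrow>
   (\<forall>u. precedes w x u \<longrightarrow> precedes w u z \<longrightarrow> v2 < u \<longrightarrow> u = y)"
proof -
  have "avoids {(1,2),(1,3),(2,2),(2,3)} w x y z [x, v2, v3] \<longleftrightarrow>
    (\<forall>u\<in>set w. precedes w x u \<longrightarrow> precedes w u z \<longrightarrow> v2 < u \<longrightarrow> u = y)"
  proof (rule avoids_iff)
    fix u assume u: "u \<in> set w"
    have "y \<in> set w"
      using prec order(3) by blast
    then have "precedes w x u \<and> precedes w u y \<or> precedes w y u \<and> precedes w u z \<longleftrightarrow>
      precedes w x u \<and> precedes w u z \<and> u \<noteq> y"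
      using u prec order(1,2) precedes_total[of u w y] by blast
    moreover have "u \<noteq> v3" if "precedes w u z" "u \<noteq> y"
      using that vals order(1) by blast
    ultimately show "(\<forall>(a, b)\<in>{(1,2),(1,3),(2,2),(2,3)}. in_column w x y z a u \<longrightarrow>
      \<not> ([0, x, v2, v3, n + 1] ! b < u \<and> u < [0, x, v2, v3, n + 1] ! (b + 1))) \<longleftrightarrow>
      (precedes w x u \<longrightarrow> precedes w u z \<longrightarrow> v2 < u \<longrightarrow> u = y)"
      using less u by (cases u v3 rule: linorder_cases) (auto simp: in_column_def numeral_eq_Suc in_range)
  qed
  then show ?thesis
    using order(3) by blast
qed

end

section \<open>Occurrences as pairs of letters beyond the pinned one\<close>

lemma order_isomorphic_123: "order_isomorphic [x, y, z] [1,2,3] \<longleftrightarrow> x < y \<and> y < z"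
  by (auto simp: order_isomorphic_def All_less_Suc2 numeral_eq_Suc)

lemma order_isomorphic_132: "order_isomorphic [x, y, z] [1,3,2] \<longleftrightarrow> x < z \<and> z < y"
  by (auto simp: order_isomorphic_def All_less_Suc2 numeral_eq_Suc)

lemma inj_on_Pair: "inj_on (Pair e) X"
  by (simp add: inj_on_def)

text \<open>Once the mesh forces \<open>x = e\<close>, a triple is determined by its last two
  letters; \<open>Q\<close> is the condition that the remaining boxes put on them.\<close>

lemma occurrences_123:
  assumes "w \<in> S n" "R \<subseteq> {0..3} \<times> {0..3}"
    "\<And>x y z. occurrence_values w n x y z y z \<Longrightarrow> avoids R w x y z [x, y, z] \<longleftrightarrow> x = e \<and> Q y z"
    "\<And>y z. precedes w e y \<and> precedes w y z \<and> e < y \<and> y < z \<and> Q y z \<longleftrightarrow> (y, z) \<in> X"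
  shows "occurrences ([1,2,3], R) w = card X"
proof -
  have "distinct w"
    using assms(1) by (simp add: S_def permutations_of_set_def)
  then have "occurrences ([1,2,3], R) w = card {(x, y, z). precedes w x y \<and> precedes w y z \<and>
    (x < y \<and> y < z) \<and> avoids R w x y z [x, y, z]}"
    by (rule occurrences_eq_card_values) (use assms(2) order_isomorphic_123 in auto)
  also have "{(x, y, z). precedes w x y \<and> precedes w y z \<and> (x < y \<and> y < z) \<and>
      avoids R w x y z [x, y, z]} =
    Pair e ` {(y, z). precedes w e y \<and> precedes w y z \<and> e < y \<and> y < z \<and> Q y z}"
    using assms(1,3) by (auto simp: occurrence_values_def)
  also have "{(y, z). precedes w e y \<and> precedes w y z \<and> e < y \<and> y < z \<and> Q y z} = X"
    unfolding assms(4) by simp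
  finally show ?thesis
    by (simp only: card_image[OF inj_on_Pair])
qed

lemma occurrences_132:
  assumes "w \<in> S n" "R \<subseteq> {0..3} \<times> {0..3}"
    "\<And>x y z. occurrence_values w n x y z z y \<Longrightarrow> avoids R w x y z [x, z, y] \<longleftrightarrow> x = e \<and> Q y z"
    "\<And>y z. precedes w e y \<and> precedes w y z \<and> e < z \<and> z < y \<and> Q y z \<longleftrightarrow> (y, z) \<in> X"
  shows "occurrences ([1,3,2], R) w = card X"
proof -
  have "distinct w"
    using assms(1) by (simp add: S_def permutations_of_set_def)
  then have "occurrences ([1,3,2], R) w = card {(x, y, z). precedes w x y \<and> precedes w y z \<and>
    (x < z \<and> z < y) \<and> avoids R w x y z [x, z, y]}"
    by (rule occurrences_eq_card_values) (use assms(2) order_isomorphic_132 in auto)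
  also have "{(x, y, z). precedes w x y \<and> precedes w y z \<and> (x < z \<and> z < y) \<and>
      avoids R w x y z [x, z, y]} =
    Pair e ` {(y, z). precedes w e y \<and> precedes w y z \<and> e < z \<and> z < y \<and> Q y z}"
    using assms(1,3) by (auto simp: occurrence_values_def)
  also have "{(y, z). precedes w e y \<and> precedes w y z \<and> e < z \<and> z < y \<and> Q y z} = X"
    unfolding assms(4) by simp
  finally show ?thesis
    by (simp only: card_image[OF inj_on_Pair])
qed

text \<open>In all four meshes the first row or column of shaded boxes pins the first letter of an
  occurrence to a letter \<open>e\<close>, and the remaining two letters lie in the word \<open>\<sigma>\<close> of the letters to
  the right of and above \<open>e\<close>.\<close>

definition upper_right :: "nat list \<Rightarrow> nat \<Rightarrow> nat list \<Rightarrow> bool" where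
  "upper_right w e \<sigma> \<longleftrightarrow>
    (\<forall>y z. precedes \<sigma> y z \<longleftrightarrow> precedes w e y \<and> e < y \<and> e < z \<and> precedes w y z)"

text \<open>Every letter of the tail comes after the head, so only the comparison of values has to
  be imposed.\<close>

lemma upper_right_filter:
  assumes "distinct w"
  shows "upper_right w (hd w) (filter (\<lambda>u. hd w < u) (tl w))"
proof (cases w)
  case (Cons a v)
  with assms show ?thesis
    by (auto simp: upper_right_def precedes_filter dest: precedes_set)
qed (simp add: upper_right_def)

text \<open>Every letter after 1 exceeds 1, so only the position has to be imposed.\<close>

lemma upper_right_suffix:
  assumes "w \<in> S n"
  shows "upper_right w 1 (suffix_after 1 w)"
proof -
  have w: "distinct w" "set w = {1..n}"
    using assms by (auto simp: S_def permutations_of_set_def)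
  have "1 < y" if "precedes w 1 y" for y
  proof -
    have "y \<in> set w" "y \<noteq> 1"
      using that precedes_set[of w] precedes_irrefl[OF w(1)] by blast+
    then show ?thesis
      using w(2) by auto
  qed
  then show ?thesis
    using precedes_trans[OF w(1)] unfolding upper_right_def precedes_suffix_after[OF w(1)] by blast
qed

text \<open>The letters after \<open>y\<close> that exceed \<open>e\<close> are the letters after
  \<open>y\<close> in \<open>\<sigma>\<close>. For \<open>123\<close> the upper bound
  \<open>v3\<close> is \<open>z\<close>, which makes \<open>z\<close> the least of them; for
  \<open>132\<close> it is \<open>y\<close>, which makes \<open>z\<close> the only one below
  \<open>y\<close>.\<close>

lemma occurrences_lower_right:
  assumes w: "w \<in> S n" and R: "R = R0 \<union> {(2,1),(2,2),(3,1),(3,2)}" "R \<subseteq> {0..3} \<times> {0..3}"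
    and pin: "\<And>x y z v2 v3. occurrence_values w n x y z v2 v3 \<Longrightarrow>
      avoids R0 w x y z [x, v2, v3] \<longleftrightarrow> x = e"
    and \<sigma>: "upper_right w e \<sigma>"
  shows "occurrences ([1,2,3], R) w = card (asc_pairs \<sigma>)"
    "occurrences ([1,3,2], R) w = card (desc_pairs \<sigma>)"
proof -
  have \<sigma>': "precedes \<sigma> y z \<longleftrightarrow> precedes w e y \<and> e < y \<and> e < z \<and> precedes w y z" for y z
    using \<sigma> by (simp add: upper_right_def)
  show "occurrences ([1,2,3], R) w = card (asc_pairs \<sigma>)"
  proof (rule occurrences_123[OF w R(2)])
    show "avoids R w x y z [x, y, z] \<longleftrightarrow> x = e \<and> (\<forall>u. precedes w y u \<longrightarrow> e < u \<longrightarrow> u < z \<longrightarrow> u = z)"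
      if "occurrence_values w n x y z y z" for x y z
      unfolding R(1) avoids_Un pin[OF that] occurrence_values.avoids_lower_right[OF that]
      by (simp cong: conj_cong)
    show "precedes w e y \<and> precedes w y z \<and> e < y \<and> y < z \<and>
      (\<forall>u. precedes w y u \<longrightarrow> e < u \<longrightarrow> u < z \<longrightarrow> u = z) \<longleftrightarrow> (y, z) \<in> asc_pairs \<sigma>" for y z
      unfolding asc_pairs_def \<sigma>' mem_Collect_eq prod.case
      by (metis less_trans not_less less_irrefl)
  qed
  show "occurrences ([1,3,2], R) w = card (desc_pairs \<sigma>)"
  proof (rule occurrences_132[OF w R(2)])
    show "avoids R w x y z [x, z, y] \<longleftrightarrow> x = e \<and> (\<forall>u. precedes w y u \<longrightarrow> e < u \<longrightarrow> u < y \<longrightarrow> u = z)"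
      if "occurrence_values w n x y z z y" for x y z
      unfolding R(1) avoids_Un pin[OF that] occurrence_values.avoids_lower_right[OF that]
      by (simp cong: conj_cong)
    show "precedes w e y \<and> precedes w y z \<and> e < z \<and> z < y \<and>
      (\<forall>u. precedes w y u \<longrightarrow> e < u \<longrightarrow> u < y \<longrightarrow> u = z) \<longleftrightarrow> (y, z) \<in> desc_pairs \<sigma>" for y z
      unfolding desc_pairs_def \<sigma>' mem_Collect_eq prod.case
      by (metis less_trans not_less less_irrefl)
  qed
qed

text \<open>The letters between \<open>e\<close> and \<open>z\<close> that exceed \<open>v2\<close>
  also exceed \<open>e\<close>, so they lie in \<open>\<sigma>\<close>. For \<open>123\<close>,
  where \<open>v2\<close> is \<open>y\<close>, the letter \<open>y\<close> becomes the greatest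
  letter of \<open>\<sigma>\<close> before \<open>z\<close>; for \<open>132\<close>, where
  \<open>v2\<close> is \<open>z\<close>, it becomes the only greater one.\<close>

lemma occurrences_upper_left:
  assumes w: "w \<in> S n" and R: "R = R0 \<union> {(1,2),(1,3),(2,2),(2,3)}" "R \<subseteq> {0..3} \<times> {0..3}"
    and pin: "\<And>x y z v2 v3. occurrence_values w n x y z v2 v3 \<Longrightarrow>
      avoids R0 w x y z [x, v2, v3] \<longleftrightarrow> x = e"
    and \<sigma>: "upper_right w e \<sigma>"
  shows "occurrences ([1,2,3], R) w = card (coasc_pairs \<sigma>)"
    "occurrences ([1,3,2], R) w = card (codesc_pairs \<sigma>)"
proof -
  have \<sigma>': "precedes \<sigma> y z \<longleftrightarrow> precedes w e y \<and> e < y \<and> e < z \<and> precedes w y z" for y z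
    using \<sigma> by (simp add: upper_right_def)
  show "occurrences ([1,2,3], R) w = card (coasc_pairs \<sigma>)"
  proof (rule occurrences_123[OF w R(2)])
    show "avoids R w x y z [x, y, z] \<longleftrightarrow> x = e \<and> (\<forall>u. precedes w e u \<longrightarrow> precedes w u z \<longrightarrow> y < u \<longrightarrow> u = y)"
      if "occurrence_values w n x y z y z" for x y z
      unfolding R(1) avoids_Un pin[OF that] occurrence_values.avoids_upper_left[OF that]
      by (simp cong: conj_cong)
    show "precedes w e y \<and> precedes w y z \<and> e < y \<and> y < z \<and>
      (\<forall>u. precedes w e u \<longrightarrow> precedes w u z \<longrightarrow> y < u \<longrightarrow> u = y) \<longleftrightarrow> (y, z) \<in> coasc_pairs \<sigma>" for y z
      unfolding coasc_pairs_def \<sigma>' mem_Collect_eq prod.case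
      by (metis less_trans not_less less_irrefl)
  qed
  show "occurrences ([1,3,2], R) w = card (codesc_pairs \<sigma>)"
  proof (rule occurrences_132[OF w R(2)])
    show "avoids R w x y z [x, z, y] \<longleftrightarrow> x = e \<and> (\<forall>u. precedes w e u \<longrightarrow> precedes w u z \<longrightarrow> z < u \<longrightarrow> u = y)"
      if "occurrence_values w n x y z z y" for x y z
      unfolding R(1) avoids_Un pin[OF that] occurrence_values.avoids_upper_left[OF that]
      by (simp cong: conj_cong)
    show "precedes w e y \<and> precedes w y z \<and> e < z \<and> z < y \<and>
      (\<forall>u. precedes w e u \<longrightarrow> precedes w u z \<longrightarrow> z < u \<longrightarrow> u = y) \<longleftrightarrow> (y, z) \<in> codesc_pairs \<sigma>" for y z
      unfolding codesc_pairs_def \<sigma>' mem_Collect_eq prod.case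
      by (metis less_trans not_less less_irrefl)
  qed
qed

section \<open>The common joint distribution\<close>

lemma joint_distribution_R:
  assumes "R \<in> {R1, R2, R3, R4}"
  shows "joint_distribution ([1,2,3], R) ([1,3,2], R) n k l = pinned_count (\<lambda>m. pair_count m k l) n"
proof -
  \<comment> \<open>Each mesh is a full column or row that pins the first letter, together with one
    of two square blocks of boxes.\<close>
  have R: "R1 = {(0,0),(0,1),(0,2),(0,3)} \<union> {(2,1),(2,2),(3,1),(3,2)}"
    "R2 = {(0,0),(0,1),(0,2),(0,3)} \<union> {(1,2),(1,3),(2,2),(2,3)}"
    "R3 = {(0,0),(1,0),(2,0),(3,0)} \<union> {(1,2),(1,3),(2,2),(2,3)}"
    "R4 = {(0,0),(1,0),(2,0),(3,0)} \<union> {(2,1),(2,2),(3,1),(3,2)}"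
    by (auto simp: R1_def R2_def R3_def R4_def)
  have sub: "R1 \<subseteq> {0..3} \<times> {0..3}" "R2 \<subseteq> {0..3} \<times> {0..3}"
    "R3 \<subseteq> {0..3} \<times> {0..3}" "R4 \<subseteq> {0..3} \<times> {0..3}"
    by (auto simp: R1_def R2_def R3_def R4_def)
  have distinct: "distinct w" if "w \<in> S n" for w
    using that by (simp add: S_def permutations_of_set_def)
  have occ: "occurrences ([1,2,3], R1) w = card (asc_pairs (filter (\<lambda>u. hd w < u) (tl w)))" (is ?o1)
    "occurrences ([1,3,2], R1) w = card (desc_pairs (filter (\<lambda>u. hd w < u) (tl w)))" (is ?o2)
    "occurrences ([1,2,3], R2) w = card (coasc_pairs (filter (\<lambda>u. hd w < u) (tl w)))" (is ?o3)
    "occurrences ([1,3,2], R2) w = card (codesc_pairs (filter (\<lambda>u. hd w < u) (tl w)))" (is ?o4)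
    "occurrences ([1,2,3], R3) w = card (coasc_pairs (suffix_after 1 w))" (is ?o5)
    "occurrences ([1,3,2], R3) w = card (codesc_pairs (suffix_after 1 w))" (is ?o6)
    "occurrences ([1,2,3], R4) w = card (asc_pairs (suffix_after 1 w))" (is ?o7)
    "occurrences ([1,3,2], R4) w = card (desc_pairs (suffix_after 1 w))" (is ?o8)
    if "w \<in> S n" for w
  proof -
    note col = upper_right_filter[OF distinct[OF that]] and row = upper_right_suffix[OF that]
    have col0: "avoids {(0,0),(0,1),(0,2),(0,3)} w x y z [x, v2, v3] \<longleftrightarrow> x = hd w"
      if "occurrence_values w n x y z v2 v3" for x y z v2 v3
      using that by (rule occurrence_values.avoids_column0)
    have row0: "avoids {(0,0),(1,0),(2,0),(3,0)} w x y z [x, v2, v3] \<longleftrightarrow> x = 1"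
      if "occurrence_values w n x y z v2 v3" for x y z v2 v3
      using that by (rule occurrence_values.avoids_row0)
    note occ = occurrences_lower_right[OF that R(1) sub(1) col0 col]
      occurrences_upper_left[OF that R(2) sub(2) col0 col]
      occurrences_upper_left[OF that R(3) sub(3) row0 row]
      occurrences_lower_right[OF that R(4) sub(4) row0 row]
    show ?o1 by (rule occ(1))
    show ?o2 by (rule occ(2))
    show ?o3 by (rule occ(3))
    show ?o4 by (rule occ(4))
    show ?o5 by (rule occ(5))
    show ?o6 by (rule occ(6))
    show ?o7 by (rule occ(7))
    show ?o8 by (rule occ(8))
  qed
  consider "R = R1" | "R = R2" | "R = R3" | "R = R4"
    using assms by blast
  then show ?thesis
  proof cases
    case 1
    show ?thesis
      using card_filter_greater_hd[where c = "\<lambda>m. pair_count m k l", OF card_permutations_asc_desc]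
      by (simp add: 1 joint_distribution_def occ(1,2) del: One_nat_def cong: conj_cong)
  next
    case 2
    show ?thesis
      using card_filter_greater_hd[where c = "\<lambda>m. pair_count m k l", OF card_permutations_coasc_codesc]
      by (simp add: 2 joint_distribution_def occ(3,4) del: One_nat_def cong: conj_cong)
  next
    case 3
    show ?thesis
      using card_suffix_after_S[where c = "\<lambda>m. pair_count m k l", OF card_permutations_coasc_codesc]
      by (simp add: 3 joint_distribution_def occ(5,6) del: One_nat_def cong: conj_cong)
  next
    case 4
    show ?thesis
      using card_suffix_after_S[where c = "\<lambda>m. pair_count m k l", OF card_permutations_asc_desc]
      by (simp add: 4 joint_distribution_def occ(7,8) del: One_nat_def cong: conj_cong)
  qed
qed

theorem theorem2p3:
  shows "(\<forall>R \<in> {R1, R2, R3, R4}. ([1,2,3], R) \<sim>\<^sub>j\<^sub>d ([1,3,2], R)) \<and>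
         (\<forall>R \<in> {R1, R2, R3, R4}. \<forall>R' \<in> {R1, R2, R3, R4}. \<forall>n k l.
            joint_distribution ([1,2,3], R) ([1,3,2], R) n k l =
            joint_distribution ([1,2,3], R') ([1,3,2], R') n k l)"
proof (intro conjI ballI allI)
  fix R assume "R \<in> {R1, R2, R3, R4}"
  note eq = joint_distribution_R[OF this]
  \<comment> \<open>The parameters \<open>k\<close> and \<open>l\<close> enter the common formula
    only through \<open>pair_count\<close>, which is symmetric in them.\<close>
  show "([1,2,3], R) \<sim>\<^sub>j\<^sub>d ([1,3,2], R)"
    unfolding jointly_equidistributed_def eq by (simp add: pair_count_commute[of _ _ l for l])
  fix R' n k l assume "R' \<in> {R1, R2, R3, R4}"
  note eq' = joint_distribution_R[OF this]
  show "joint_distribution ([1,2,3], R) ([1,3,2], R) n k l =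
      joint_distribution ([1,2,3], R') ([1,3,2], R') n k l"
    by (simp only: eq eq')
qed

end
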